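(* Let $\Gamma^\sharp$ be an abstract BitML configuration in which no recursion variable $\mathsf X$ occurs (as a parallel component). Then, for all contract names $x$: $x$ is liquid in $\Gamma^\sharp$ with respect to the LTS $\to_\sharp$ and the label set $\mathcal L^\sharp$ if and only if $x$ is liquid in $\Gamma^\sharp$ with respect to the LTS $\to_{\sharp\mathit{fin}}$ and the label set $\mathcal L^\sharp$.
   Context: **Abstract contracts and configurations.** Fix participants $P,Q,\dots$, an infinite set of contract names $x,y,z,\dots$, and a finite set of recursion variables $\mathsf X,\mathsf Y,\dots$. Abstract contracts are $C ::= \sum_{i\in I}D_i$ ($I$ finite; $0$ is the empty sum), where abstract guarded contracts are $D ::= \mathtt{withdraw}\,P\mid\tau.C\mid\mathtt{split}\,\|_{i}(\to C_i)\mid{*}{:}D\mid{*}{:}\mathtt{rngt}\,\mathsf X$ (splits have finitely many components), with ${*}{:}{*}{:}D$ identified with ${*}{:}D$. (These terms are abstractions of BitML smart contracts w.r.t. a fixed honest participant $A$: a prefix ${*}{:}$ marks actions that may need the cooperation of participants other than $A$.) Each recursion variable $\mathsf X$ has a unique abstract defining equation $\mathsf X=_\sharp C$ with $C$ an abstract contract. Abstract configurations are finite parallel compositions ($|$ with unit $0$, a commutative monoid) of terms $\langle C\rangle_x$, with distinct names $x$, and of recursion variables $\mathsf X$ (possibly repeated). Occurrences of $\mathsf X$ in a configuration refer to these parallel components, not to occurrences inside ${*}{:}\mathtt{rngt}\,\mathsf X$. $\mathrm{cn}(\Gamma)$ is the set of $x$ such that $\Gamma$ contains some $\langle C\rangle_x$.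 **Abstract semantics** $\Gamma\xrightarrow{\ell}_\sharp\Gamma'$, with labels $x$ or ${*}{:}x$ (${*}{:}{*}{:}\ell$ identified with ${*}{:}\ell$; $\mathrm{cn}(x)=\mathrm{cn}({*}{:}x)=\{x\}$), where $\Gamma$ is an arbitrary abstract configuration and "fresh" names are names not occurring so far in the run: - $\langle\mathtt{withdraw}\,P\rangle_x|\Gamma\xrightarrow{x}_\sharp\Gamma$; - $\langle\tau.C\rangle_x|\Gamma\xrightarrow{x}_\sharp\langle C\rangle_y|\Gamma$, $y$ fresh; - $\langle\mathtt{split}\,\|_i(\to C_i)\rangle_x|\Gamma\xrightarrow{x}_\sharp\|_i\langle C_i\rangle_{y_i}|\Gamma$, $y_i$ fresh and distinct; - if $\langle D\rangle_x|\Gamma\xrightarrow{\ell}_\sharp\Gamma'$ and $x\in\mathrm{cn}(\ell)$, then $\langle D+C\rangle_x|\Gamma\xrightarrow{\ell}_\sharp\Gamma'$; - if $\langle D\rangle_x|\Gamma\xrightarrow{\ell}_\sharp\Gamma'$ and $x\in\mathrm{cn}(\ell)$, then $\langle{*}{:}D\rangle_x|\Gamma\xrightarrow{{*}:\ell}_\sharp\Gamma'$; - if $\mathsf X=_\sharp C$, then $\langle{*}{:}\mathtt{rngt}\,\mathsf X\rangle_x|\Gamma\xrightarrow{{*}:x}_\sharp\langle C\rangle_y|\mathsf X|\Gamma$, $y$ fresh. $\mathcal L^\sharp$ is the set of labels of the form $x$ (i.e. without ${*}$). **Finite-state semantics.** $\Gamma\xrightarrow{\ell}_{\sharp\mathit{fin}}\Gamma'$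 iff $\Gamma\xrightarrow{\ell}_\sharp\Gamma'$ and there are no $\Delta,\mathsf X$ with $\Gamma'=\Delta\,|\,\mathsf X\,|\,\mathsf X$. **Origin and liquidity** (for an LTS $\to$, here $\to_\sharp$ or $\to_{\sharp\mathit{fin}}$). For a run $\mathcal R$ from $\Gamma$, the partial function $\mathrm{orig}_\Gamma$ is: $\mathrm{orig}_\Gamma(\Gamma,x)=x$ if $x\in\mathrm{cn}(\Gamma)$; and, if $\Gamma_{\mathcal R}$ is the last configuration of $\mathcal R$, $\mathrm{orig}_\Gamma(\mathcal R\xrightarrow{\ell}\Gamma',x)$ equals $\mathrm{orig}_\Gamma(\mathcal R,x)$ if $x\in\mathrm{cn}(\Gamma_{\mathcal R})\cap\mathrm{cn}(\Gamma')$, and equals $\mathrm{orig}_\Gamma(\mathcal R,y)$ if $x\in\mathrm{cn}(\Gamma')\setminus\mathrm{cn}(\Gamma_{\mathcal R})$ and $\{y\}=\mathrm{cn}(\Gamma_{\mathcal R})\setminus\mathrm{cn}(\Gamma')$; undefined otherwise. Given a set of labels $\mathcal L$: a name $x$ is *liquidable* in $\Gamma$ if there is a finite run $\mathcal R=\Gamma\xrightarrow{\ell_1}\cdots\xrightarrow{\ell_n}\Gamma'$ with all $\ell_i\in\mathcal L$ such that no $z\in\mathrm{cn}(\Gamma')$ has $\mathrm{orig}_\Gamma(\mathcal R,z)=x$. A name $x$ is *liquid* in $\Gamma$ if for all finite runs $\mathcal R=\Gamma\to\cdots\to\Gamma'$ (any labels), every $y$ with $\mathrm{orig}_\Gamma(\mathcal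 R,y)=x$ is liquidable in $\Gamma'$. *)

theory Defs
  imports Main "HOL-Library.Multiset" "HOL-Library.Infinite_Typeclass"
begin

text \<open>
  Type variables: \<open>'p\<close> participants, \<open>'v\<close> recursion variables, \<open>'n\<close> contract names.

  Contracts are represented in normal form with respect to the identification of
  \<open>*:*:D\<close> with \<open>*:D\<close>: a guarded contract carries at most one star, and \<open>rngt\<close> always
  carries one. Sums and splits are multisets, so \<open>+\<close> and the parallel composition inside
  a split are commutative and associative, and \<open>0\<close> is \<open>Sum {#}\<close>.
\<close>

datatype ('p, 'v) contract = Sum "('p, 'v) guarded multiset"
  and ('p, 'v) guarded =
    Plain "('p, 'v) action"
  | Starred "('p, 'v) action"
  | StarredRngt 'v
  and ('p, 'v) action =
    Withdraw 'p
  | Tau "('p, 'v) contract"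
  | Split "('p, 'v) contract multiset"

fun star :: "('p, 'v) guarded \<Rightarrow> ('p, 'v) guarded" where
  "star (Plain a) = Starred a"
| "star (Starred a) = Starred a"
| "star (StarredRngt X) = StarredRngt X"

abbreviation single :: "('p, 'v) guarded \<Rightarrow> ('p, 'v) contract" where
  "single D \<equiv> Sum {#D#}"

fun plus_contract :: "('p, 'v) guarded \<Rightarrow> ('p, 'v) contract \<Rightarrow> ('p, 'v) contract" where
  "plus_contract D (Sum Ds) = Sum (add_mset D Ds)"

datatype 'n label = PlainL 'n | StarredL 'n

fun star_label :: "'n label \<Rightarrow> 'n label" where
  "star_label (PlainL x) = StarredL x"
| "star_label (StarredL x) = StarredL x"

fun cn_label :: "'n label \<Rightarrow> 'n set" where
  "cn_label (PlainL x) = {x}"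
| "cn_label (StarredL x) = {x}"

definition plain_labels :: "'n label set" where
  "plain_labels = range PlainL"

text \<open>
  \<open>Active C x\<close> is the term \<open>\<langle>C\<rangle>\<^sub>x\<close>. Parallel composition is multiset union; distinctness
  of names is imposed by \<open>configuration\<close>.
\<close>

datatype ('p, 'v, 'n) component =
    Active "('p, 'v) contract" 'n
  | RecVar 'v

type_synonym ('p, 'v, 'n) config = "('p, 'v, 'n) component multiset"

definition cn :: "('p, 'v, 'n) config \<Rightarrow> 'n set" where
  "cn \<Gamma> = {x. \<exists>C. Active C x \<in># \<Gamma>}"

definition configuration :: "('p, 'v, 'n) config \<Rightarrow> bool" where
  "configuration \<Gamma> \<longleftrightarrow>
     (\<forall>C C' x \<Delta>. \<Gamma> \<noteq> add_mset (Active C x) (add_mset (Active C' x) \<Delta>))"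

text \<open>
  In \<open>step eqn N \<Gamma> l \<Gamma>'\<close>, the equation for \<open>X\<close> is \<open>X = eqn X\<close>, and \<open>N\<close> is the set of names
  that occurred so far in the run (including those of \<open>\<Gamma>\<close>, see \<open>is_run\<close> below): a name is
  fresh iff it is not in \<open>N\<close>.
\<close>

inductive step ::
    "('v \<Rightarrow> ('p, 'v) contract) \<Rightarrow> 'n set \<Rightarrow>
     ('p, 'v, 'n) config \<Rightarrow> 'n label \<Rightarrow> ('p, 'v, 'n) config \<Rightarrow> bool"
  for eqn :: "'v \<Rightarrow> ('p, 'v) contract" and N :: "'n set" where
  withdraw:
    "step eqn N (add_mset (Active (single (Plain (Withdraw P))) x) \<Gamma>) (PlainL x) \<Gamma>"
| tau:
    "y \<notin> N \<Longrightarrow>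
     step eqn N (add_mset (Active (single (Plain (Tau C))) x) \<Gamma>) (PlainL x)
       (add_mset (Active C y) \<Gamma>)"
| split:
    "length ys = length Cs \<Longrightarrow> distinct ys \<Longrightarrow> set ys \<inter> N = {} \<Longrightarrow>
     step eqn N (add_mset (Active (single (Plain (Split (mset Cs)))) x) \<Gamma>) (PlainL x)
       (mset (map2 Active Cs ys) + \<Gamma>)"
| sum:
    "step eqn N (add_mset (Active (single D) x) \<Gamma>) l \<Gamma>' \<Longrightarrow> x \<in> cn_label l \<Longrightarrow>
     step eqn N (add_mset (Active (plus_contract D C) x) \<Gamma>) l \<Gamma>'"
| star:
    "step eqn N (add_mset (Active (single D) x) \<Gamma>) l \<Gamma>' \<Longrightarrow> x \<in> cn_label l \<Longrightarrow>
     step eqn N (add_mset (Active (single (star D)) x) \<Gamma>) (star_label l) \<Gamma>'"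
| rngt:
    "y \<notin> N \<Longrightarrow>
     step eqn N (add_mset (Active (single (StarredRngt X)) x) \<Gamma>) (StarredL x)
       (add_mset (Active (eqn X) y) (add_mset (RecVar X) \<Gamma>))"

definition fin_step ::
    "('v \<Rightarrow> ('p, 'v) contract) \<Rightarrow> 'n set \<Rightarrow>
     ('p, 'v, 'n) config \<Rightarrow> 'n label \<Rightarrow> ('p, 'v, 'n) config \<Rightarrow> bool" where
  "fin_step eqn N \<Gamma> l \<Gamma>' \<longleftrightarrow>
     step eqn N \<Gamma> l \<Gamma>' \<and> (\<nexists>\<Delta> X. \<Gamma>' = \<Delta> + {#RecVar X#} + {#RecVar X#})"

text \<open>
  Since freshness refers to the history of the run, an LTS is a relation with the set of
  names used so far as an additional parameter.
\<close>

type_synonym ('p, 'v, 'n) lts =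
  "'n set \<Rightarrow> ('p, 'v, 'n) config \<Rightarrow> 'n label \<Rightarrow> ('p, 'v, 'n) config \<Rightarrow> bool"

datatype ('p, 'v, 'n) run =
    Init "('p, 'v, 'n) config"
  | Ext "('p, 'v, 'n) run" "'n label" "('p, 'v, 'n) config"

primrec first_config :: "('p, 'v, 'n) run \<Rightarrow> ('p, 'v, 'n) config" where
  "first_config (Init \<Gamma>) = \<Gamma>"
| "first_config (Ext R l \<Gamma>') = first_config R"

primrec last_config :: "('p, 'v, 'n) run \<Rightarrow> ('p, 'v, 'n) config" where
  "last_config (Init \<Gamma>) = \<Gamma>"
| "last_config (Ext R l \<Gamma>') = \<Gamma>'"

primrec run_labels :: "('p, 'v, 'n) run \<Rightarrow> 'n label set" where
  "run_labels (Init \<Gamma>) = {}"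
| "run_labels (Ext R l \<Gamma>') = insert l (run_labels R)"

primrec run_names :: "('p, 'v, 'n) run \<Rightarrow> 'n set" where
  "run_names (Init \<Gamma>) = cn \<Gamma>"
| "run_names (Ext R l \<Gamma>') = run_names R \<union> cn \<Gamma>'"

primrec is_run :: "('p, 'v, 'n) lts \<Rightarrow> ('p, 'v, 'n) run \<Rightarrow> bool" where
  "is_run lts (Init \<Gamma>) \<longleftrightarrow> True"
| "is_run lts (Ext R l \<Gamma>') \<longleftrightarrow>
     is_run lts R \<and> lts (run_names R) (last_config R) l \<Gamma>'"

primrec orig :: "('p, 'v, 'n) run \<Rightarrow> 'n \<Rightarrow> 'n option" where
  "orig (Init \<Gamma>) x = (if x \<in> cn \<Gamma> then Some x else None)"
| "orig (Ext R l \<Gamma>') x =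
     (if x \<in> cn (last_config R) \<inter> cn \<Gamma>' then orig R x
      else if x \<in> cn \<Gamma>' - cn (last_config R) \<and> is_singleton (cn (last_config R) - cn \<Gamma>')
      then orig R (the_elem (cn (last_config R) - cn \<Gamma>'))
      else None)"

definition liquidable ::
    "('p, 'v, 'n) lts \<Rightarrow> 'n label set \<Rightarrow> ('p, 'v, 'n) config \<Rightarrow> 'n \<Rightarrow> bool" where
  "liquidable lts L \<Gamma> x \<longleftrightarrow>
     (\<exists>R. is_run lts R \<and> first_config R = \<Gamma> \<and> run_labels R \<subseteq> L \<and>
          (\<forall>z \<in> cn (last_config R). orig R z \<noteq> Some x))"

definition liquid ::
    "('p, 'v, 'n) lts \<Rightarrow> 'n label set \<Rightarrow> ('p, 'v, 'n) config \<Rightarrow> 'n \<Rightarrow> bool" where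
  "liquid lts L \<Gamma> x \<longleftrightarrow>
     (\<forall>R y. is_run lts R \<and> first_config R = \<Gamma> \<and> orig R y = Some x
        \<longrightarrow> liquidable lts L (last_config R) y)"

end

theory Submission
  imports Defs
begin

text \<open>
  A run with plain labels never unfolds a recursion variable, so whether a name can be liquidated
  depends only on its own contract. Both notions of liquidity thus say that every contract reachable
  from that of \<open>x\<close> can be dissolved. Such a contract is already reachable by firing only
  the ancestors of its name, and since every call of \<open>X\<close> leads to the same contract, loops between
  two calls of \<open>X\<close> can be cut out. The resulting run calls each recursion variable at most once, so
  it is a run of the finite-state semantics.
\<close>

section \<open>Names in configurations\<close>

text \<open>The part created by a firing. Lists fix which name each continuation receives; the
  continuations come only as a multiset, so an enumeration of them is chosen at each use.\<close>

definition spawn :: "('p, 'v) contract list \<Rightarrow> 'n list \<Rightarrow> ('p, 'v, 'n) config" where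
  "spawn Cs ys = mset (map2 Active Cs ys)"

lemma spawn_Nil [simp]: "spawn [] [] = {#}"
  by (simp add: spawn_def)

lemma spawn_Cons [simp]: "spawn (C # Cs) (y # ys) = add_mset (Active C y) (spawn Cs ys)"
  by (simp add: spawn_def)

lemma cn_empty [simp]: "cn {#} = {}"
  by (simp add: cn_def)

lemma cn_add_Active [simp]: "cn (add_mset (Active C x) \<Gamma>) = insert x (cn \<Gamma>)"
  by (auto simp: cn_def)

lemma cn_union [simp]: "cn (\<Gamma> + \<Delta>) = cn \<Gamma> \<union> cn \<Delta>"
  by (auto simp: cn_def)

lemma cn_RecVars [simp]: "cn (image_mset RecVar V) = {}"
  by (auto simp: cn_def)

lemma cn_spawn [simp]: "length ys = length Cs \<Longrightarrow> cn (spawn Cs ys) = set ys"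
  by (induction ys Cs rule: list_induct2) auto

lemma finite_cn [simp]: "finite (cn \<Gamma>)"
proof -
  have "cn \<Gamma> \<subseteq> (\<lambda>c. case c of Active C x \<Rightarrow> x | RecVar X \<Rightarrow> undefined) ` set_mset \<Gamma>"
    by (force simp: cn_def)
  then show ?thesis
    by (rule finite_subset) simp
qed

lemma configuration_empty [simp]: "configuration {#}"
  by (simp add: configuration_def)

lemma configuration_add_Active [simp]:
  "configuration (add_mset (Active C x) \<Gamma>) \<longleftrightarrow> x \<notin> cn \<Gamma> \<and> configuration \<Gamma>"
proof (intro iffI conjI)
  assume conf: "configuration (add_mset (Active C x) \<Gamma>)"
  show "x \<notin> cn \<Gamma>"
    using conf unfolding configuration_def cn_def by (blast dest: multi_member_split)
  show "configuration \<Gamma>"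
    unfolding configuration_def
  proof (intro allI notI)
    fix C1 C2 y \<Delta>
    assume "\<Gamma> = add_mset (Active C1 y) (add_mset (Active C2 y) \<Delta>)"
    then have "add_mset (Active C x) \<Gamma> =
        add_mset (Active C1 y) (add_mset (Active C2 y) (add_mset (Active C x) \<Delta>))"
      by (simp add: add_mset_commute)
    then show False
      using conf unfolding configuration_def by blast
  qed
next
  assume asm: "x \<notin> cn \<Gamma> \<and> configuration \<Gamma>"
  show "configuration (add_mset (Active C x) \<Gamma>)"
    unfolding configuration_def
  proof (intro allI notI)
    fix C1 C2 y \<Delta>
    assume eq: "add_mset (Active C x) \<Gamma> = add_mset (Active C1 y) (add_mset (Active C2 y) \<Delta>)"
    show False
    proof (cases "x = y")
      case True
      \<comment> \<open>At least two components are named \<open>y\<close>; removing the displayed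
        one leaves another inside \<open>\<Gamma>\<close>.\<close>
      have "size (filter_mset (\<lambda>c. \<exists>C. c = Active C y) (add_mset (Active C x) \<Gamma>)) \<ge> 2"
        unfolding eq by simp
      then have "size (filter_mset (\<lambda>c. \<exists>C. c = Active C y) \<Gamma>) \<noteq> 0"
        using True by (simp del: size_eq_0_iff_empty)
      then obtain C' where "Active C' y \<in># \<Gamma>"
        by auto
      then show False
        using asm True by (auto simp: cn_def)
    next
      \<comment> \<open>\<open>Active C x\<close> differs from both components named
        \<open>y\<close>, so it can be cancelled, which exposes the duplicate in
        \<open>\<Gamma>\<close>.\<close>
      case False
      then have "Active C x \<in># \<Delta>"
        using arg_cong[OF eq, of "\<lambda>M. Active C x \<in># M"] by auto
      then obtain \<Delta>' where "\<Delta> = add_mset (Active C x) \<Delta>'"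
        by (blast dest: multi_member_split)
      then have "\<Gamma> = add_mset (Active C1 y) (add_mset (Active C2 y) \<Delta>')"
        using eq by (simp add: add_mset_commute)
      then show False
        using asm unfolding configuration_def by blast
    qed
  qed
qed

lemma configuration_add_RecVars [simp]:
  "configuration (image_mset RecVar V + \<Gamma>) \<longleftrightarrow> configuration \<Gamma>"
proof
  assume conf: "configuration (image_mset RecVar V + \<Gamma>)"
  show "configuration \<Gamma>"
    unfolding configuration_def
  proof (intro allI notI)
    fix C C' x \<Delta>
    assume "\<Gamma> = add_mset (Active C x) (add_mset (Active C' x) \<Delta>)"
    then have "image_mset RecVar V + \<Gamma> =
        add_mset (Active C x) (add_mset (Active C' x) (image_mset RecVar V + \<Delta>))"
      by simp
    then show False
      using conf unfolding configuration_def by blast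
  qed
next
  assume conf: "configuration \<Gamma>"
  show "configuration (image_mset RecVar V + \<Gamma>)"
    unfolding configuration_def
  proof (intro allI notI)
    fix C C' x \<Delta>
    assume "image_mset RecVar V + \<Gamma> = add_mset (Active C x) (add_mset (Active C' x) \<Delta>)"
    \<comment> \<open>The filter deletes the image of \<open>V\<close> and keeps both active
      components, so the duplicate pair is already contained in \<open>\<Gamma>\<close>.\<close>
    then have "filter_mset (\<lambda>c. \<forall>X. c \<noteq> RecVar X) (image_mset RecVar V + \<Gamma>) =
        filter_mset (\<lambda>c. \<forall>X. c \<noteq> RecVar X) (add_mset (Active C x) (add_mset (Active C' x) \<Delta>))"
      by simp
    then have "add_mset (Active C x) (add_mset (Active C' x) {#}) \<subseteq>#
        filter_mset (\<lambda>c. \<forall>X. c \<noteq> RecVar X) \<Gamma>"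
      by (simp add: filter_mset_image_mset)
    also have "\<dots> \<subseteq># \<Gamma>"
      by simp
    finally obtain \<Delta>' where "\<Gamma> = add_mset (Active C x) (add_mset (Active C' x) {#}) + \<Delta>'"
      by (auto simp: subset_mset.le_iff_add)
    then show False
      using conf unfolding configuration_def by auto
  qed
qed

lemma configuration_spawn:
  "length ys = length Cs \<Longrightarrow> distinct ys \<Longrightarrow> set ys \<inter> cn \<Gamma> = {} \<Longrightarrow> configuration \<Gamma> \<Longrightarrow>
   configuration (spawn Cs ys + \<Gamma>)"
  by (induction ys Cs rule: list_induct2) auto

text \<open>Distinct names make a name identify its contract; this recovers the firing component
  from the label of a step.\<close>

lemma configuration_unique:
  assumes "configuration \<Gamma>" "Active C x \<in># \<Gamma>" "Active C' x \<in># \<Gamma>"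
  shows "C = C'"
proof (rule ccontr)
  assume "C \<noteq> C'"
  then have "\<exists>\<Delta>. \<Gamma> = add_mset (Active C x) (add_mset (Active C' x) \<Delta>)"
    using assms(2,3) by (metis component.inject(1) insert_noteq_member multi_member_split)
  then show False
    using assms(1) unfolding configuration_def by blast
qed

section \<open>A uniform description of the steps\<close>

fun action_conts :: "('p, 'v) action \<Rightarrow> ('p, 'v) contract multiset" where
  "action_conts (Withdraw P) = {#}"
| "action_conts (Tau C) = {#C#}"
| "action_conts (Split Cs) = Cs"

text \<open>The effect of a summand is given by \<open>conts\<close>, \<open>calls\<close> and
  \<open>guarded_label\<close>; a star changes only the label. Unfolding \<open>X\<close> counts as
  having the single continuation \<open>eqn X\<close>.\<close>

fun conts :: "('v \<Rightarrow> ('p, 'v) contract) \<Rightarrow> ('p, 'v) guarded \<Rightarrow> ('p, 'v) contract multiset" where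
  "conts eqn (Plain a) = action_conts a"
| "conts eqn (Starred a) = action_conts a"
| "conts eqn (StarredRngt X) = {#eqn X#}"

fun calls :: "('p, 'v) guarded \<Rightarrow> 'v multiset" where
  "calls (StarredRngt X) = {#X#}"
| "calls _ = {#}"

fun guarded_label :: "('p, 'v) guarded \<Rightarrow> 'n \<Rightarrow> 'n label" where
  "guarded_label (Plain a) x = PlainL x"
| "guarded_label _ x = StarredL x"

lemma cn_guarded_label [simp]: "cn_label (guarded_label D x) = {x}"
  by (cases D) auto

lemma conts_star [simp]: "conts eqn (star D) = conts eqn D"
  by (cases D) auto

lemma calls_star [simp]: "calls (star D) = calls D"
  by (cases D) auto

lemma guarded_label_star [simp]: "guarded_label (star D) x = star_label (guarded_label D x)"
  by (cases D) auto

lemma guarded_label_plain_iff: "guarded_label D x \<in> plain_labels \<longleftrightarrow> (\<exists>a. D = Plain a)"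
  by (cases D) (auto simp: plain_labels_def)

text \<open>All rules of \<open>step\<close> in one. The firing contract, its name and the rest
  \<open>\<Delta>\<close> are separate arguments, so case analysis does not have to split a
  multiset.\<close>

inductive fires ::
    "('v \<Rightarrow> ('p, 'v) contract) \<Rightarrow> 'n set \<Rightarrow> ('p, 'v) contract \<Rightarrow> 'n \<Rightarrow> ('p, 'v, 'n) config \<Rightarrow>
     'n label \<Rightarrow> ('p, 'v, 'n) config \<Rightarrow> bool"
  for eqn N where
  firesI: "D \<in># Ds \<Longrightarrow> mset Cs = conts eqn D \<Longrightarrow> length ys = length Cs \<Longrightarrow> distinct ys \<Longrightarrow>
     set ys \<inter> N = {} \<Longrightarrow>
     fires eqn N (Sum Ds) x \<Delta> (guarded_label D x) (spawn Cs ys + (image_mset RecVar (calls D) + \<Delta>))"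

lemma fires_cn_label: "fires eqn N C x \<Delta> l \<Gamma>' \<Longrightarrow> cn_label l = {x}"
  by (auto elim: fires.cases)

lemma fires_plus_contract:
  assumes "fires eqn N (single D) x \<Delta> l \<Gamma>'"
  shows "fires eqn N (plus_contract D C) x \<Delta> l \<Gamma>'"
  using assms by (cases C) (auto elim!: fires.cases intro!: firesI)

lemma fires_star:
  assumes "fires eqn N (single D) x \<Delta> l \<Gamma>'"
  shows "fires eqn N (single (star D)) x \<Delta> (star_label l) \<Gamma>'"
  using assms
proof cases
  case (firesI D' Cs ys)
  then show ?thesis
    using fires.firesI[of "star D" "{#star D#}" Cs eqn ys N x \<Delta>] by auto
qed

text \<open>Rule induction. For \<open>sum\<close> and \<open>star\<close> the induction hypothesis
  yields some firing component; the label gives its name, and distinctness of names identifies it as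
  \<open>single D\<close>.\<close>

lemma step_imp_fires:
  assumes "step eqn N \<Gamma> l \<Gamma>'" and "configuration \<Gamma>"
  shows "\<exists>C x \<Delta>. \<Gamma> = add_mset (Active C x) \<Delta> \<and> fires eqn N C x \<Delta> l \<Gamma>'"
  using assms
proof induction
  case (withdraw P x \<Gamma>)
  show ?case
    using firesI[of "Plain (Withdraw P)" "{#Plain (Withdraw P)#}" "[]" eqn "[]" N x \<Gamma>] by auto
next
  case (tau y C x \<Gamma>)
  then show ?case
    using firesI[of "Plain (Tau C)" "{#Plain (Tau C)#}" "[C]" eqn "[y]" N x \<Gamma>] by auto
next
  case (split ys Cs x \<Gamma>)
  then show ?case
    using firesI[of "Plain (Split (mset Cs))" "{#Plain (Split (mset Cs))#}" Cs eqn ys N x \<Gamma>]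
    by (auto simp: spawn_def)
next
  case (sum D x \<Gamma> l \<Gamma>' C)
  have conf: "configuration (add_mset (Active (single D) x) \<Gamma>)"
    using sum.prems by simp
  obtain C' x' \<Delta> where eq: "add_mset (Active (single D) x) \<Gamma> = add_mset (Active C' x') \<Delta>"
    and f: "fires eqn N C' x' \<Delta> l \<Gamma>'"
    using sum.IH[OF conf] by blast
  have "x' = x"
    using fires_cn_label[OF f] sum.hyps by simp
  moreover from this have "C' = single D"
    using configuration_unique[OF conf, of C' x "single D"] eq by (metis union_single_eq_member)
  ultimately show ?case
    using eq fires_plus_contract[of eqn N D x \<Delta> l \<Gamma>' C] f
    by (intro exI[of _ "plus_contract D C"] exI[of _ x] exI[of _ \<Delta>]) auto
next
  case (star D x \<Gamma> l \<Gamma>')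
  have conf: "configuration (add_mset (Active (single D) x) \<Gamma>)"
    using star.prems by simp
  obtain C' x' \<Delta> where eq: "add_mset (Active (single D) x) \<Gamma> = add_mset (Active C' x') \<Delta>"
    and f: "fires eqn N C' x' \<Delta> l \<Gamma>'"
    using star.IH[OF conf] by blast
  have "x' = x"
    using fires_cn_label[OF f] star.hyps by simp
  moreover from this have "C' = single D"
    using configuration_unique[OF conf, of C' x "single D"] eq by (metis union_single_eq_member)
  ultimately show ?case
    using eq fires_star[of eqn N D x \<Delta> l \<Gamma>'] f
    by (intro exI[of _ "single (star D)"] exI[of _ x] exI[of _ \<Delta>]) auto
next
  case (rngt y X x \<Gamma>)
  then show ?case
    using firesI[of "StarredRngt X" "{#StarredRngt X#}" "[eqn X]" eqn "[y]" N x \<Gamma>]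
    by (auto simp: add_mset_commute)
qed

lemma action_step:
  assumes "mset Cs = action_conts a" "length ys = length Cs" "distinct ys" "set ys \<inter> N = {}"
  shows "step eqn N (add_mset (Active (single (Plain a)) x) \<Delta>) (PlainL x) (spawn Cs ys + \<Delta>)"
proof (cases a)
  case (Withdraw P)
  then show ?thesis
    using assms by (auto intro: step.withdraw)
next
  case (Tau C)
  then obtain y where "Cs = [C]" "ys = [y]"
    using assms by (auto simp: length_Suc_conv)
  then show ?thesis
    using assms Tau by (auto intro: step.tau)
next
  case (Split M)
  then show ?thesis
    using assms step.split[of ys Cs N eqn x \<Delta>] by (auto simp: spawn_def)
qed

text \<open>\<open>Starred a\<close> is \<open>star (Plain a)\<close>, so the rule
  \<open>star\<close> on top of \<open>action_step\<close> covers it; a final use of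
  \<open>sum\<close> adds the remaining summands.\<close>

lemma fires_imp_step:
  assumes "fires eqn N C x \<Delta> l \<Gamma>'"
  shows "step eqn N (add_mset (Active C x) \<Delta>) l \<Gamma>'"
  using assms
proof cases
  case (firesI D Ds Cs ys)
  have single: "step eqn N (add_mset (Active (single D) x) \<Delta>) l \<Gamma>'"
  proof (cases D)
    case (Plain a)
    then show ?thesis
      using firesI action_step[of Cs a ys N eqn x \<Delta>] by simp
  next
    case (Starred a)
    then show ?thesis
      using firesI step.star[OF action_step[of Cs a ys N eqn x \<Delta>]] by simp
  next
    case (StarredRngt X)
    then obtain y where "Cs = [eqn X]" "ys = [y]"
      using firesI by (auto simp: length_Suc_conv)
    then show ?thesis
      using firesI StarredRngt step.rngt[of y N eqn X x \<Delta>] by (simp add: add_mset_commute)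
  qed
  obtain Ds' where "Ds = add_mset D Ds'"
    using firesI(4) by (blast dest: multi_member_split)
  then show ?thesis
    using step.sum[OF single, of "Sum Ds'"] firesI by simp
qed

lemma fires_configuration:
  assumes "fires eqn N C x \<Delta> l \<Gamma>'" "configuration \<Delta>" "cn \<Delta> \<subseteq> N"
  shows "configuration \<Gamma>'"
  using assms(1)
proof cases
  case (firesI D Ds Cs ys)
  then show ?thesis
    using assms by (auto intro!: configuration_spawn)
qed

text \<open>New names avoid \<open>N\<close>, which contains \<open>x\<close> and
  \<open>cn \<Delta>\<close>, and \<open>x\<close> is not in \<open>cn \<Delta>\<close>. Hence
  \<open>x\<close> is the only name that disappears, and the singleton test in \<open>orig\<close>
  succeeds with \<open>x\<close>.\<close>

lemma fires_orig:
  assumes "last_config R = add_mset (Active C x) \<Delta>" "configuration (last_config R)"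
    "insert x (cn \<Delta>) \<subseteq> N" "fires eqn N C x \<Delta> l \<Gamma>'"
  shows "orig (Ext R l \<Gamma>') z =
    (if z \<in> cn \<Delta> then orig R z else if z \<in> cn \<Gamma>' then orig R x else None)"
  using assms(4)
proof cases
  case (firesI D Ds Cs ys)
  then have cn': "cn \<Gamma>' = set ys \<union> cn \<Delta>"
    by simp
  have diff: "insert x (cn \<Delta>) - (set ys \<union> cn \<Delta>) = {x}" and "x \<notin> set ys"
    using assms firesI by auto
  show ?thesis
    using assms(1-3) firesI(8) \<open>x \<notin> set ys\<close>
    by (auto simp: cn' diff is_singleton_def)
qed

section \<open>Runs\<close>

lemma cn_last_config: "cn (last_config R) \<subseteq> run_names R"
  by (cases R) auto

lemma finite_run_names [simp]: "finite (run_names R)"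
  by (induction R) auto

lemma is_run_mono: "is_run lts R \<Longrightarrow> lts \<le> lts' \<Longrightarrow> is_run lts' R"
  by (induction R) (auto simp: le_fun_def)

lemma fin_step_le_step: "fin_step eqn \<le> step eqn"
  by (auto simp: fin_step_def le_fun_def)

lemma run_configuration:
  "is_run (step eqn) R \<Longrightarrow> configuration (first_config R) \<Longrightarrow> configuration (last_config R)"
proof (induction R)
  case (Ext R l \<Gamma>')
  then have conf: "configuration (last_config R)"
    and st: "step eqn (run_names R) (last_config R) l \<Gamma>'"
    by auto
  obtain C x \<Delta> where eq: "last_config R = add_mset (Active C x) \<Delta>"
    and f: "fires eqn (run_names R) C x \<Delta> l \<Gamma>'"
    using step_imp_fires[OF st conf] by blast
  show ?case
    using fires_configuration[OF f] conf cn_last_config[of R] by (simp add: eq)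
qed simp

text \<open>Packages the last step of a run for the two inductions that track \<open>orig\<close>
  along arbitrary runs.\<close>

lemma run_Ext_cases:
  assumes "is_run (step eqn) (Ext R l \<Gamma>')" "configuration (first_config R)"
  obtains C x \<Delta> where "is_run (step eqn) R" "last_config R = add_mset (Active C x) \<Delta>"
    "fires eqn (run_names R) C x \<Delta> l \<Gamma>'"
    "\<And>z. orig (Ext R l \<Gamma>') z =
      (if z \<in> cn \<Delta> then orig R z else if z \<in> cn \<Gamma>' then orig R x else None)"
proof -
  have conf: "configuration (last_config R)"
    using assms run_configuration by auto
  obtain C x \<Delta> where eq: "last_config R = add_mset (Active C x) \<Delta>"
    and f: "fires eqn (run_names R) C x \<Delta> l \<Gamma>'"
    using step_imp_fires[OF _ conf] assms(1) by (metis is_run.simps(2))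
  have "insert x (cn \<Delta>) \<subseteq> run_names R"
    using cn_last_config[of R] by (simp add: eq)
  then show ?thesis
    using that[OF _ eq f fires_orig[OF eq conf _ f]] assms(1) by simp
qed

lemma ex_fresh_names:
  fixes N :: "'n::infinite set"
  assumes "finite N"
  shows "\<exists>ys. length ys = n \<and> distinct ys \<and> set ys \<inter> N = {}"
proof -
  have "infinite (- N)"
    using assms by (simp add: infinite_UNIV Compl_eq_Diff_UNIV)
  then obtain A where "finite A" "card A = n" "A \<subseteq> - N"
    by (meson infinite_arbitrarily_large)
  then show ?thesis
    using finite_distinct_list[of A] distinct_card by fastforce
qed

section \<open>Liquidability depends on the contract only\<close>

text \<open>Consumable by unstarred actions alone; \<open>eqn\<close> does not enter because
  \<open>rngt\<close> always carries a star. The base cases are actions without continuations: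
  \<open>Withdraw\<close> and the empty split.\<close>

inductive dissolves :: "('p, 'v) contract \<Rightarrow> bool" where
  dissolvesI: "Plain a \<in># Ds \<Longrightarrow> (\<And>C. C \<in># action_conts a \<Longrightarrow> dissolves C) \<Longrightarrow> dissolves (Sum Ds)"

lemma spawn_member:
  assumes "length ys = length Cs" "C \<in> set Cs"
  obtains y where "y \<in> set ys" "Active C y \<in># spawn Cs ys"
  using assms by (induction ys Cs rule: list_induct2) auto

lemma spawn_memberD: "Active C y \<in># spawn Cs ys \<Longrightarrow> C \<in> set Cs \<and> y \<in> set ys"
  by (auto simp: spawn_def dest: set_zip_leftD set_zip_rightD)

text \<open>If a component that does not dissolve fires a plain action, some continuation does not
  dissolve either, by contraposition of \<open>dissolvesI\<close>. So such a descendant of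
  \<open>x\<close> survives every plain step.\<close>

lemma not_dissolves_run:
  assumes "is_run (step eqn) R" "configuration (first_config R)" "run_labels R \<subseteq> plain_labels"
    "Active C x \<in># first_config R" "\<not> dissolves C"
  shows "\<exists>C' z. Active C' z \<in># last_config R \<and> \<not> dissolves C' \<and> orig R z = Some x"
  using assms
proof (induction R)
  case (Init \<Gamma>)
  then show ?case
    by (auto simp: cn_def)
next
  case (Ext R l \<Gamma>')
  obtain B w \<Delta> where run: "is_run (step eqn) R" and eq: "last_config R = add_mset (Active B w) \<Delta>"
    and f: "fires eqn (run_names R) B w \<Delta> l \<Gamma>'"
    and orig: "\<And>z. orig (Ext R l \<Gamma>') z =
      (if z \<in> cn \<Delta> then orig R z else if z \<in> cn \<Gamma>' then orig R w else None)"
    using run_Ext_cases[OF Ext.prems(1)] Ext.prems(2) by (metis first_config.simps(2))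
  obtain C' z where z: "Active C' z \<in># last_config R" "\<not> dissolves C'" "orig R z = Some x"
    using Ext.IH[OF run] Ext.prems by auto
  from f show ?case
  proof cases
    case (firesI D Ds Cs ys)
    show ?thesis
    proof (cases "Active C' z \<in># \<Delta>")
      case True
      then have "z \<in> cn \<Delta>"
        by (auto simp: cn_def)
      then show ?thesis
        using True z firesI orig[of z] by (intro exI[of _ C'] exI[of _ z]) auto
    next
      case False
      then have zw: "z = w" "C' = B"
        using z eq by auto
      \<comment> \<open>Only an unstarred summand produces a plain label, which is the form that
        \<open>dissolvesI\<close> asks for.\<close>
      obtain a where "D = Plain a"
        using Ext.prems(3) firesI by (auto simp: guarded_label_plain_iff)
      then obtain E where E: "E \<in> set Cs" "\<not> dissolves E"
        using z(2) zw firesI dissolvesI[of a Ds] by (metis conts.simps(1) set_mset_mset)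
      obtain y where y: "y \<in> set ys" "Active E y \<in># spawn Cs ys"
        using spawn_member[OF firesI(6) E(1)] by blast
      then have "y \<notin> cn \<Delta>" "y \<in> cn \<Gamma>'"
        using firesI cn_last_config[of R] eq by auto
      then show ?thesis
        using y E z zw firesI orig[of y] by (intro exI[of _ E] exI[of _ y]) auto
    qed
  qed
qed

text \<open>Plain steps leave this part unchanged; it is all that the side condition of
  \<open>fin_step\<close> looks at.\<close>

definition rec_vars :: "('p, 'v, 'n) config \<Rightarrow> ('p, 'v, 'n) config" where
  "rec_vars \<Gamma> = filter_mset (\<lambda>c. \<exists>X. c = RecVar X) \<Gamma>"

lemma rec_vars_add_Active [simp]: "rec_vars (add_mset (Active C x) \<Gamma>) = rec_vars \<Gamma>"
  by (simp add: rec_vars_def)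

lemma rec_vars_spawn [simp]:
  "length ys = length Cs \<Longrightarrow> rec_vars (spawn Cs ys + \<Gamma>) = rec_vars \<Gamma>"
  by (induction ys Cs rule: list_induct2) auto

text \<open>The rest of the configuration is left untouched, so that the components spawned by a split
  can be erased one after the other.\<close>

definition erasable :: "('p, 'v, 'n) lts \<Rightarrow> ('p, 'v, 'n) config \<Rightarrow> ('p, 'v) contract \<Rightarrow> bool" where
  "erasable lts V C \<longleftrightarrow>
     (\<forall>R x \<Delta>. is_run lts R \<longrightarrow> last_config R = add_mset (Active C x) \<Delta> \<longrightarrow>
        configuration (last_config R) \<longrightarrow> run_labels R \<subseteq> plain_labels \<longrightarrow> rec_vars \<Delta> = V \<longrightarrow>
        (\<exists>R'. is_run lts R' \<and> first_config R' = first_config R \<and> last_config R' = \<Delta> \<and>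
           run_labels R' \<subseteq> plain_labels \<and> (\<forall>z \<in> cn \<Delta>. orig R' z = orig R z)))"

text \<open>Erasing the head leaves the spawned tail and \<open>\<Delta>\<close> with their origins
  unchanged, so the induction continues from the extended run. Spawned components are active, hence
  \<open>V\<close> stays fixed.\<close>

lemma erasable_spawn:
  assumes "length ys = length Cs" "\<forall>C \<in> set Cs. erasable lts V C"
    "is_run lts R" "last_config R = spawn Cs ys + \<Delta>" "configuration (last_config R)"
    "run_labels R \<subseteq> plain_labels" "rec_vars \<Delta> = V"
  shows "\<exists>R'. is_run lts R' \<and> first_config R' = first_config R \<and> last_config R' = \<Delta> \<and>
     run_labels R' \<subseteq> plain_labels \<and> (\<forall>z \<in> cn \<Delta>. orig R' z = orig R z)"
  using assms
proof (induction ys Cs arbitrary: R rule: list_induct2)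
  case Nil
  then show ?case
    by auto
next
  case (Cons y ys C Cs)
  have "last_config R = add_mset (Active C y) (spawn Cs ys + \<Delta>)"
    using Cons.prems by simp
  moreover have "rec_vars (spawn Cs ys + \<Delta>) = V"
    using Cons.prems Cons.hyps by simp
  ultimately obtain R1 where R1: "is_run lts R1" "first_config R1 = first_config R"
    "last_config R1 = spawn Cs ys + \<Delta>" "run_labels R1 \<subseteq> plain_labels"
    "\<forall>z \<in> cn (spawn Cs ys + \<Delta>). orig R1 z = orig R z"
    using Cons.prems unfolding erasable_def by (metis list.set_intros(1))
  have "configuration (last_config R1)"
    using Cons.prems R1 by simp
  then obtain R' where "is_run lts R'" "first_config R' = first_config R1" "last_config R' = \<Delta>"
    "run_labels R' \<subseteq> plain_labels" "\<forall>z \<in> cn \<Delta>. orig R' z = orig R1 z"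
    using Cons.IH[of R1] Cons.prems R1 by auto
  then show ?case
    using R1 by (intro exI[of _ R']) simp
qed

text \<open>Fire the plain summand, then erase its continuations. All configurations added to the
  run have recursion variables \<open>V\<close>, so the assumption admits every step;
  \<open>lts\<close> is general in order to serve both semantics.\<close>

lemma dissolves_erasable:
  fixes lts :: "('p, 'v, 'n::infinite) lts"
  assumes "dissolves C"
    and lts: "\<And>N \<Gamma> l \<Gamma>'. step eqn N \<Gamma> l \<Gamma>' \<Longrightarrow> rec_vars \<Gamma>' = V \<Longrightarrow> lts N \<Gamma> l \<Gamma>'"
  shows "erasable lts V C"
  using assms(1)
proof induction
  case (dissolvesI a Ds)
  show ?case
    unfolding erasable_def
  proof (intro allI impI)
    fix R x \<Delta>
    assume run: "is_run lts R" and last: "last_config R = add_mset (Active (Sum Ds) x) \<Delta>"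
      and conf: "configuration (last_config R)" and labels: "run_labels R \<subseteq> plain_labels"
      and V: "rec_vars \<Delta> = V"
    obtain Cs where Cs: "mset Cs = action_conts a"
      using ex_mset by blast
    obtain ys where ys: "length ys = length Cs" "distinct ys" "set ys \<inter> run_names R = {}"
      using ex_fresh_names[of "run_names R"] by auto
    define \<Gamma>' where "\<Gamma>' = spawn Cs ys + \<Delta>"
    have f: "fires eqn (run_names R) (Sum Ds) x \<Delta> (PlainL x) \<Gamma>'"
      using firesI[of "Plain a" Ds Cs eqn ys "run_names R" x \<Delta>] dissolvesI(1) Cs ys
      by (simp add: \<Gamma>'_def)
    have names: "insert x (cn \<Delta>) \<subseteq> run_names R"
      using cn_last_config[of R] by (simp add: last)
    have orig: "\<forall>z \<in> cn \<Delta>. orig (Ext R (PlainL x) \<Gamma>') z = orig R z"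
      using fires_orig[OF last conf names f] by simp
    have run': "is_run lts (Ext R (PlainL x) \<Gamma>')"
      using run lts[OF fires_imp_step[OF f]] ys V last by (simp add: \<Gamma>'_def)
    have conf': "configuration \<Gamma>'"
      using fires_configuration[OF f] conf names last by simp
    have "\<forall>C \<in> set Cs. erasable lts V C"
      using dissolvesI(3) Cs by (metis set_mset_mset)
    then obtain R' where "is_run lts R'" "first_config R' = first_config R" "last_config R' = \<Delta>"
      "run_labels R' \<subseteq> plain_labels" "\<forall>z \<in> cn \<Delta>. orig R' z = orig (Ext R (PlainL x) \<Gamma>') z"
      using erasable_spawn[OF ys(1) _ run', of V \<Delta>] conf' labels V
      by (auto simp: \<Gamma>'_def plain_labels_def)
    then show "\<exists>R'. is_run lts R' \<and> first_config R' = first_config R \<and> last_config R' = \<Delta> \<and>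
        run_labels R' \<subseteq> plain_labels \<and> (\<forall>z \<in> cn \<Delta>. orig R' z = orig R z)"
      using orig by (intro exI[of _ R']) simp
  qed
qed

text \<open>The assumptions bound \<open>lts\<close> from both sides: lying below
  \<open>step eqn\<close> makes \<open>not_dissolves_run\<close> applicable, and containing the
  steps that end with the recursion variables of \<open>\<Gamma>\<close> suffices for
  erasing.\<close>

lemma liquidable_iff_dissolves:
  fixes lts :: "('p, 'v, 'n::infinite) lts"
  assumes "lts \<le> step eqn"
    and lts: "\<And>N \<Gamma>1 l \<Gamma>2. step eqn N \<Gamma>1 l \<Gamma>2 \<Longrightarrow> rec_vars \<Gamma>2 = rec_vars \<Gamma> \<Longrightarrow> lts N \<Gamma>1 l \<Gamma>2"
    and "configuration \<Gamma>" "Active C y \<in># \<Gamma>"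
  shows "liquidable lts plain_labels \<Gamma> y \<longleftrightarrow> dissolves C"
proof
  assume "liquidable lts plain_labels \<Gamma> y"
  then obtain R where "is_run lts R" "first_config R = \<Gamma>" "run_labels R \<subseteq> plain_labels"
    and none: "\<forall>z \<in> cn (last_config R). orig R z \<noteq> Some y"
    unfolding liquidable_def by blast
  then have "\<exists>C' z. Active C' z \<in># last_config R \<and> orig R z = Some y" if "\<not> dissolves C"
    using not_dissolves_run[of eqn R C y] that assms is_run_mono by blast
  then show "dissolves C"
    using none by (auto simp: cn_def)
next
  assume "dissolves C"
  obtain \<Delta> where \<Delta>: "\<Gamma> = add_mset (Active C y) \<Delta>"
    using assms(4) by (blast dest: multi_member_split)
  have "erasable lts (rec_vars \<Gamma>) C"
    by (rule dissolves_erasable[OF \<open>dissolves C\<close> lts])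
  \<comment> \<open>In a run extending \<open>Init \<Gamma>\<close>, each surviving name is its own
    origin; \<open>y\<close> is not among them.\<close>
  then obtain R where "is_run lts R" "first_config R = \<Gamma>" "last_config R = \<Delta>"
    "run_labels R \<subseteq> plain_labels" "\<forall>z \<in> cn \<Delta>. orig R z = orig (Init \<Gamma>) z"
    unfolding erasable_def using assms(3) \<Delta>
    by (metis empty_subsetI first_config.simps(1) is_run.simps(1) last_config.simps(1)
        rec_vars_add_Active run_labels.simps(1))
  moreover have "y \<notin> cn \<Delta>"
    using assms(3) \<Delta> by simp
  ultimately show "liquidable lts plain_labels \<Gamma> y"
    unfolding liquidable_def by (intro exI[of _ R]) auto
qed

section \<open>Reachable contracts\<close>

text \<open>\<open>V\<close> collects the recursion variables called on the path, each at most once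
  by the side condition. Only one continuation is followed at a split; its siblings are
  forgotten.\<close>

inductive reach ::
    "('v \<Rightarrow> ('p, 'v) contract) \<Rightarrow> ('p, 'v) contract \<Rightarrow> 'v set \<Rightarrow> ('p, 'v) contract \<Rightarrow> bool"
  for eqn C0 where
  refl: "reach eqn C0 {} C0"
| cont: "reach eqn C0 V (Sum Ds) \<Longrightarrow> D \<in># Ds \<Longrightarrow> C \<in># conts eqn D \<Longrightarrow> set_mset (calls D) \<inter> V = {} \<Longrightarrow>
     reach eqn C0 (V \<union> set_mset (calls D)) C"

text \<open>The call of \<open>X\<close> put \<open>eqn X\<close> on the path, so the path cut right
  after that call ends there.\<close>

lemma reach_called: "reach eqn C0 V C \<Longrightarrow> X \<in> V \<Longrightarrow> \<exists>V'. reach eqn C0 V' (eqn X)"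
proof (induction rule: reach.induct)
  case (cont V Ds D C)
  show ?case
  proof (cases "X \<in> V")
    case False
    then have "D = StarredRngt X"
      using cont.prems by (cases D) auto
    then show ?thesis
      using reach.cont[OF cont.hyps(1,2), of C] cont.hyps by auto
  qed (use cont.IH in blast)
qed simp

text \<open>This cuts a loop: a second call of \<open>X\<close> leads to \<open>eqn X\<close>, which
  the first call already reached. Reachability thus becomes closed under all continuations, with a
  possibly different set \<open>V'\<close>.\<close>

lemma reach_conts:
  assumes "reach eqn C0 V (Sum Ds)" "D \<in># Ds" "C \<in># conts eqn D"
  shows "\<exists>V'. reach eqn C0 V' C"
proof (cases "set_mset (calls D) \<inter> V = {}")
  case True
  then show ?thesis
    using reach.cont[OF assms] by blast
next
  case False
  then obtain X where "D = StarredRngt X" "X \<in> V"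
    by (cases D) auto
  then show ?thesis
    using reach_called[OF assms(1)] assms(3) by auto
qed

text \<open>A component untouched by a step keeps its path. A spawned one is a continuation of the
  fired contract and inherits its origin, so \<open>reach_conts\<close> extends that path.\<close>

lemma run_reach:
  assumes "is_run (step eqn) R" "configuration (first_config R)"
    "Active C y \<in># last_config R" "orig R y = Some x"
  shows "\<exists>C0 V. Active C0 x \<in># first_config R \<and> reach eqn C0 V C"
  using assms
proof (induction R arbitrary: C y)
  case (Init \<Gamma>)
  then show ?case
    by (auto split: if_splits intro: reach.refl)
next
  case (Ext R l \<Gamma>')
  obtain B w \<Delta> where run: "is_run (step eqn) R" and eq: "last_config R = add_mset (Active B w) \<Delta>"
    and f: "fires eqn (run_names R) B w \<Delta> l \<Gamma>'"
    and orig: "\<And>z. orig (Ext R l \<Gamma>') z =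
      (if z \<in> cn \<Delta> then orig R z else if z \<in> cn \<Gamma>' then orig R w else None)"
    using run_Ext_cases[OF Ext.prems(1)] Ext.prems(2) by (metis first_config.simps(2))
  note IH = Ext.IH[OF run]
  have conf: "configuration (first_config R)"
    using Ext.prems by simp
  from f show ?case
  proof cases
    case (firesI D Ds Cs ys)
    consider "Active C y \<in># \<Delta>" | "Active C y \<in># spawn Cs ys"
      using Ext.prems(3) firesI by auto
    then show ?thesis
    proof cases
      case 1
      then have "y \<in> cn \<Delta>"
        by (auto simp: cn_def)
      then show ?thesis
        using IH[OF conf, of C y] 1 orig[of y] Ext.prems(4) eq by simp
    next
      case 2
      then have C: "C \<in># conts eqn D" and "y \<in> set ys"
        using spawn_memberD[OF 2] firesI by (metis set_mset_mset, blast)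
      then have "y \<notin> cn \<Delta>" "y \<in> cn \<Gamma>'"
        using firesI cn_last_config[of R] eq by auto
      then have "orig R w = Some x"
        using orig[of y] Ext.prems(4) by simp
      then obtain C0 V where "Active C0 x \<in># first_config R" "reach eqn C0 V B"
        using IH[OF conf, of B w] eq by auto
      then show ?thesis
        using reach_conts[of eqn C0 V Ds D C] C firesI by auto
    qed
  qed
qed

text \<open>Each step of \<open>reach\<close> is replayed by firing the current descendant of
  \<open>x\<close>. The exact count strengthens the induction: \<open>\<Gamma>\<close> has no
  recursion variables, so those present are \<open>V\<close>, once each, and the side condition of
  \<open>cont\<close> prevents a duplicate.\<close>

lemma reach_run:
  fixes \<Gamma> :: "('p, 'v, 'n::infinite) config"
  assumes "reach eqn C0 V C" "configuration \<Gamma>" "\<forall>X. RecVar X \<notin># \<Gamma>" "Active C0 x \<in># \<Gamma>"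
  shows "\<exists>R y. is_run (fin_step eqn) R \<and> first_config R = \<Gamma> \<and> Active C y \<in># last_config R \<and>
    orig R y = Some x \<and> (\<forall>X. count (last_config R) (RecVar X) = (if X \<in> V then 1 else 0))"
  using assms(1)
proof induction
  case refl
  show ?case
    using assms by (intro exI[of _ "Init \<Gamma>"] exI[of _ x]) (auto simp: cn_def count_eq_zero_iff)
next
  case (cont V Ds D C)
  then obtain R w where R: "is_run (fin_step eqn) R" "first_config R = \<Gamma>"
    "Active (Sum Ds) w \<in># last_config R" "orig R w = Some x"
    and count: "\<And>X. count (last_config R) (RecVar X) = (if X \<in> V then 1 else 0)"
    by auto
  have conf: "configuration (last_config R)"
    using R assms is_run_mono[OF _ fin_step_le_step] run_configuration by blast
  obtain \<Delta> where \<Delta>: "last_config R = add_mset (Active (Sum Ds) w) \<Delta>"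
    using R(3) by (blast dest: multi_member_split)
  obtain Cs where Cs: "mset Cs = conts eqn D"
    using ex_mset by blast
  obtain ys where ys: "length ys = length Cs" "distinct ys" "set ys \<inter> run_names R = {}"
    using ex_fresh_names[of "run_names R"] by auto
  define l where "l = guarded_label D w"
  define \<Gamma>' where "\<Gamma>' = spawn Cs ys + (image_mset RecVar (calls D) + \<Delta>)"
  have f: "fires eqn (run_names R) (Sum Ds) w \<Delta> l \<Gamma>'"
    unfolding l_def \<Gamma>'_def by (rule firesI) (use cont.hyps Cs ys in auto)
  have names: "insert w (cn \<Delta>) \<subseteq> run_names R"
    using cn_last_config[of R] by (simp add: \<Delta>)
  have "count (spawn Cs ys) (RecVar X :: ('p, 'v, 'n) component) = 0" for X
    by (auto simp: spawn_def count_eq_zero_iff)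
  moreover have "count (image_mset RecVar (calls D)) (RecVar X :: ('p, 'v, 'n) component) =
      (if X \<in># calls D then 1 else 0)" for X
    by (cases D) auto
  ultimately have count': "count \<Gamma>' (RecVar X) = (if X \<in> V \<union> set_mset (calls D) then 1 else 0)" for X
    using count[of X] cont.hyps(4) by (auto simp: \<Gamma>'_def \<Delta> split: if_splits)
  have "fin_step eqn (run_names R) (last_config R) l \<Gamma>'"
    unfolding fin_step_def
  proof (intro conjI notI)
    show "step eqn (run_names R) (last_config R) l \<Gamma>'"
      using fires_imp_step[OF f] \<Delta> by simp
  next
    assume "\<exists>\<Delta> X. \<Gamma>' = \<Delta> + {#RecVar X#} + {#RecVar X#}"
    then obtain \<Delta>' X where "\<Gamma>' = \<Delta>' + {#RecVar X#} + {#RecVar X#}"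
      by blast
    then have "count \<Gamma>' (RecVar X) \<ge> 2"
      by simp
    then show False
      using count'[of X] by (simp split: if_splits)
  qed
  then have run: "is_run (fin_step eqn) (Ext R l \<Gamma>')"
    using R(1) by simp
  have "C \<in> set Cs"
    using cont.hyps(3) Cs by (metis set_mset_mset)
  then obtain y where y: "y \<in> set ys" "Active C y \<in># spawn Cs ys"
    using spawn_member[OF ys(1)] by blast
  have "y \<notin> cn \<Delta>" "y \<in> cn \<Gamma>'"
    using y ys names by (auto simp: \<Gamma>'_def)
  then have "orig (Ext R l \<Gamma>') y = Some x"
    unfolding fires_orig[OF \<Delta> conf names f] using R(4) by simp
  then show ?case
    using run R(2) y count' by (intro exI[of _ "Ext R l \<Gamma>'"] exI[of _ y]) (auto simp: \<Gamma>'_def)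
qed

text \<open>\<open>fin_step\<close> constrains only the targets of steps; the assumption on the
  first configuration covers the run without steps.\<close>

lemma fin_run_no_duplicates:
  assumes "is_run (fin_step eqn) R" "\<forall>X. RecVar X \<notin># first_config R"
  shows "\<nexists>\<Delta> X. last_config R = \<Delta> + {#RecVar X#} + {#RecVar X#}"
  using assms by (cases R) (auto simp: fin_step_def)

lemma orig_Some_Active: "orig R y = Some x \<Longrightarrow> \<exists>C. Active C y \<in># last_config R"
  by (cases R) (auto simp: cn_def split: if_splits)

text \<open>\<open>orig\<close> is defined only on names of the last configuration, so every
  descendant of \<open>x\<close> has a contract to which the assumption applies.\<close>

lemma liquid_iff_dissolves:
  assumes "\<And>R y C. is_run lts R \<Longrightarrow> first_config R = \<Gamma> \<Longrightarrow> Active C y \<in># last_config R \<Longrightarrow>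
    liquidable lts L (last_config R) y \<longleftrightarrow> dissolves C"
  shows "liquid lts L \<Gamma> x \<longleftrightarrow>
    (\<forall>R y C. is_run lts R \<and> first_config R = \<Gamma> \<and> orig R y = Some x \<and>
       Active C y \<in># last_config R \<longrightarrow> dissolves C)"
proof
  assume all: "\<forall>R y C. is_run lts R \<and> first_config R = \<Gamma> \<and> orig R y = Some x \<and>
    Active C y \<in># last_config R \<longrightarrow> dissolves C"
  show "liquid lts L \<Gamma> x"
    unfolding liquid_def
  proof (intro allI impI)
    fix R y
    assume R: "is_run lts R \<and> first_config R = \<Gamma> \<and> orig R y = Some x"
    then obtain C where "Active C y \<in># last_config R"
      using orig_Some_Active[of R y x] by blast
    then show "liquidable lts L (last_config R) y"
      using assms[of R C y] all R by blast
  qed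
qed (use assms in \<open>unfold liquid_def, blast\<close>)

section \<open>Equivalence of the two notions of liquidity\<close>

lemma liquid_step_iff:
  fixes \<Gamma> :: "('p, 'v, 'n::infinite) config"
  assumes "configuration \<Gamma>"
  shows "liquid (step eqn) plain_labels \<Gamma> x \<longleftrightarrow>
    (\<forall>R y C. is_run (step eqn) R \<and> first_config R = \<Gamma> \<and> orig R y = Some x \<and>
       Active C y \<in># last_config R \<longrightarrow> dissolves C)"
  using assms run_configuration
  by (intro liquid_iff_dissolves liquidable_iff_dissolves[of "step eqn" eqn]) auto

lemma liquid_fin_step_iff:
  fixes \<Gamma> :: "('p, 'v, 'n::infinite) config"
  assumes "configuration \<Gamma>" "\<forall>X. RecVar X \<notin># \<Gamma>"
  shows "liquid (fin_step eqn) plain_labels \<Gamma> x \<longleftrightarrow>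
    (\<forall>R y C. is_run (fin_step eqn) R \<and> first_config R = \<Gamma> \<and> orig R y = Some x \<and>
       Active C y \<in># last_config R \<longrightarrow> dissolves C)"
proof (rule liquid_iff_dissolves)
  fix R y C
  assume run: "is_run (fin_step eqn) R" "first_config R = \<Gamma>" "Active C y \<in># last_config R"
  show "liquidable (fin_step eqn) plain_labels (last_config R) y \<longleftrightarrow> dissolves C"
  proof (rule liquidable_iff_dissolves[OF fin_step_le_step])
    fix N \<Gamma>1 l \<Gamma>2
    assume st: "step eqn N \<Gamma>1 l \<Gamma>2" and rv: "rec_vars \<Gamma>2 = rec_vars (last_config R)"
    \<comment> \<open>\<open>\<Gamma>2\<close> has the same recursion variables as the end of a
      finite-state run, where none occurs twice, so it passes the test of
      \<open>fin_step\<close>.\<close>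
    have "count \<Gamma>2 (RecVar X) < 2" for X
    proof (rule ccontr)
      assume "\<not> count \<Gamma>2 (RecVar X) < 2"
      moreover have "count \<Gamma>2 (RecVar X) = count (last_config R) (RecVar X)"
        using arg_cong[OF rv, of "\<lambda>M. count M (RecVar X)"] by (simp add: rec_vars_def)
      ultimately have "replicate_mset 2 (RecVar X) \<subseteq># last_config R"
        using count_le_replicate_mset_subset_eq[of 2 "last_config R" "RecVar X"] by simp
      then obtain \<Delta> where "last_config R = replicate_mset 2 (RecVar X) + \<Delta>"
        by (auto simp: subset_mset.le_iff_add)
      then have "last_config R = \<Delta> + {#RecVar X#} + {#RecVar X#}"
        by (simp add: numeral_2_eq_2)
      then show False
        using fin_run_no_duplicates[OF run(1)] run(2) assms(2) by blast
    qed
    then have "\<nexists>\<Delta> X. \<Gamma>2 = \<Delta> + {#RecVar X#} + {#RecVar X#}"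
      by (metis add.commute count_add_mset less_2_cases_iff add_mset_add_single nat.distinct(1) nat.inject One_nat_def)
    then show "fin_step eqn N \<Gamma>1 l \<Gamma>2"
      using st by (simp add: fin_step_def)
  next
    show "configuration (last_config R)"
      using run assms(1) is_run_mono[OF _ fin_step_le_step] run_configuration by blast
  qed (rule run)
qed

theorem theorem5p10:
  fixes eqn :: "'v::finite \<Rightarrow> ('p, 'v) contract"
    and \<Gamma> :: "('p, 'v, 'n::infinite) config"
  assumes "configuration \<Gamma>"
    and "\<forall>X. RecVar X \<notin># \<Gamma>"
  shows "\<forall>x. liquid (step eqn) plain_labels \<Gamma> x \<longleftrightarrow> liquid (fin_step eqn) plain_labels \<Gamma> x"
proof
  fix x
  \<comment> \<open>Both characterizations depend only on which contracts the descendants of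
    \<open>x\<close> can carry; the runs and names realizing them may differ.\<close>
  have "(\<exists>R y. is_run (step eqn) R \<and> first_config R = \<Gamma> \<and> orig R y = Some x \<and>
        Active C y \<in># last_config R) \<longleftrightarrow>
      (\<exists>R y. is_run (fin_step eqn) R \<and> first_config R = \<Gamma> \<and> orig R y = Some x \<and>
        Active C y \<in># last_config R)" for C
  proof
    assume "\<exists>R y. is_run (step eqn) R \<and> first_config R = \<Gamma> \<and> orig R y = Some x \<and>
      Active C y \<in># last_config R"
    \<comment> \<open>\<open>run_reach\<close> extracts a path without repeated calls, and
      \<open>reach_run\<close> replays it in the finite-state semantics.\<close>
    then obtain C0 V where "Active C0 x \<in># \<Gamma>" "reach eqn C0 V C"
      using run_reach assms(1) by metis
    then show "\<exists>R y. is_run (fin_step eqn) R \<and> first_config R = \<Gamma> \<and> orig R y = Some x \<and>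
      Active C y \<in># last_config R"
      using reach_run[OF _ assms] by metis
  qed (use is_run_mono[OF _ fin_step_le_step] in blast)
  then show "liquid (step eqn) plain_labels \<Gamma> x \<longleftrightarrow> liquid (fin_step eqn) plain_labels \<Gamma> x"
    unfolding liquid_step_iff[OF assms(1)] liquid_fin_step_iff[OF assms] by metis
qed

end
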